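(* Let $P$ be a set with a symmetric and reflexive relation $\mathcal{C}$, and let $E=[E,\leq,\varepsilon]$ be a heap in $H(P,\mathcal{C})$. Suppose the concurrency subgraph of $E$ contains no circuits. Then the following are equivalent: (i) $E$ is ranked; (ii) every subinterval of $E$ is ranked; (iii) every minimal balanced subinterval of $E$ is ranked.
   Context: A labelled heap with pieces in $P$ is a triple $(E,\leq,\varepsilon)$ with $(E,\leq)$ a finite (possibly empty) poset and $\varepsilon:E\to P$ a map such that: (1) if $\alpha,\beta\in E$ and $\varepsilon(\alpha)\,\mathcal{C}\,\varepsilon(\beta)$ then $\alpha,\beta$ are comparable; (2) $\leq$ is the transitive closure of the relation $\leq_{\mathcal{C}}$ defined by $\alpha\leq_{\mathcal{C}}\beta$ iff $\alpha\leq\beta$ and $\varepsilon(\alpha)\,\mathcal{C}\,\varepsilon(\beta)$. A heap is a labelled heap up to label-preserving poset isomorphism; $H(P,\mathcal{C})$ is the set of such heaps, and one works with a representative. $\varepsilon(x)$ is called the label of $x$. The concurrency subgraph of $E$ is the simple graph with vertex set $\{\varepsilon(x):x\in E\}$, with an edge between $v\neq w$ iff $v\,\mathcal{C}\,w$; a circuit is a cycle in this graph. In a poset, $a<b$ is a covering relation if there is no $c$ with $a<c<b$. A rank function is a map $\rho:E\to\mathbb{Z}$ with $\rho(b)=\rho(a)+1$ whenever $a<b$ is a covering relation; the poset (or heap) is ranked if a rank function exists. For $a,b\in E$, the subinterval $[a,b]=\{x\in E: a\leq x\leq b\}$ with the order inherited from $E$. It is balanced if $\varepsilon(a)=\varepsilon(b)$,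 and a balanced subinterval is minimal if $a\neq b$ and the only $c\in[a,b]$ with $\varepsilon(c)=\varepsilon(a)$ are $c=a$ and $c=b$. *)

theory Defs
  imports "Graph_Theory.Graph_Theory"
begin

definition covering :: "'a set \<Rightarrow> 'a rel \<Rightarrow> 'a \<Rightarrow> 'a \<Rightarrow> bool" where
  "covering A le a b \<longleftrightarrow> a \<in> A \<and> b \<in> A \<and> (a, b) \<in> le \<and> a \<noteq> b \<and>
     \<not> (\<exists>c\<in>A. (a, c) \<in> le \<and> a \<noteq> c \<and> (c, b) \<in> le \<and> c \<noteq> b)"

definition rank_function :: "'a set \<Rightarrow> 'a rel \<Rightarrow> ('a \<Rightarrow> int) \<Rightarrow> bool" where
  "rank_function A le \<rho> \<longleftrightarrow> (\<forall>a b. covering A le a b \<longrightarrow> \<rho> b = \<rho> a + 1)"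

definition ranked :: "'a set \<Rightarrow> 'a rel \<Rightarrow> bool" where
  "ranked A le \<longleftrightarrow> (\<exists>\<rho>. rank_function A le \<rho>)"

definition subinterval :: "'a set \<Rightarrow> 'a rel \<Rightarrow> 'a \<Rightarrow> 'a \<Rightarrow> 'a set" where
  "subinterval E le a b = {x \<in> E. (a, x) \<in> le \<and> (x, b) \<in> le}"

definition subinterval_ranked :: "'a set \<Rightarrow> 'a rel \<Rightarrow> 'a \<Rightarrow> 'a \<Rightarrow> bool" where
  "subinterval_ranked E le a b \<longleftrightarrow>
     ranked (subinterval E le a b) (Restr le (subinterval E le a b))"

definition balanced :: "('a \<Rightarrow> 'p) \<Rightarrow> 'a \<Rightarrow> 'a \<Rightarrow> bool" where
  "balanced \<epsilon> a b \<longleftrightarrow> \<epsilon> a = \<epsilon> b"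

(* The set equality entails a \<le> b, since it puts a and b in the subinterval. *)
definition minimal_balanced :: "'a set \<Rightarrow> 'a rel \<Rightarrow> ('a \<Rightarrow> 'p) \<Rightarrow> 'a \<Rightarrow> 'a \<Rightarrow> bool" where
  "minimal_balanced E le \<epsilon> a b \<longleftrightarrow> balanced \<epsilon> a b \<and> a \<noteq> b \<and>
     {c \<in> subinterval E le a b. \<epsilon> c = \<epsilon> a} = {a, b}"

definition concurrency_relation :: "'p set \<Rightarrow> 'p rel \<Rightarrow> bool" where
  "concurrency_relation P C \<longleftrightarrow> C \<subseteq> P \<times> P \<and> refl_on P C \<and> sym C"

type_synonym ('a, 'p) labelled = "'a set \<times> 'a rel \<times> ('a \<Rightarrow> 'p)"

(* partial_order_on E le includes le \<subseteq> E \<times> E.  The labelling is total on the type;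
   only its values on E are used. *)
fun labelled_heap :: "'p set \<Rightarrow> 'p rel \<Rightarrow> ('a, 'p) labelled \<Rightarrow> bool" where
  "labelled_heap P C (E, le, \<epsilon>) \<longleftrightarrow>
     finite E \<and> partial_order_on E le \<and> \<epsilon> ` E \<subseteq> P \<and>
     (\<forall>\<alpha>\<in>E. \<forall>\<beta>\<in>E. (\<epsilon> \<alpha>, \<epsilon> \<beta>) \<in> C \<longrightarrow> (\<alpha>, \<beta>) \<in> le \<or> (\<beta>, \<alpha>) \<in> le) \<and>
     le = {(\<alpha>, \<beta>). (\<alpha>, \<beta>) \<in> le \<and> (\<epsilon> \<alpha>, \<epsilon> \<beta>) \<in> C}\<^sup>+"

fun label_isomorphic :: "('a, 'p) labelled \<Rightarrow> ('b, 'p) labelled \<Rightarrow> bool" where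
  "label_isomorphic (E, le, \<epsilon>) (E', le', \<epsilon>') \<longleftrightarrow>
     (\<exists>f. bij_betw f E E' \<and>
          (\<forall>x\<in>E. \<forall>y\<in>E. (x, y) \<in> le \<longleftrightarrow> (f x, f y) \<in> le') \<and>
          (\<forall>x\<in>E. \<epsilon>' (f x) = \<epsilon> x))"

definition heap_isomorphism :: "'p set \<Rightarrow> 'p rel \<Rightarrow> ('a, 'p) labelled rel" where
  "heap_isomorphism P C =
     {(h, h'). labelled_heap P C h \<and> labelled_heap P C h' \<and> label_isomorphic h h'}"

(* H(P, C): isomorphism classes of labelled heaps whose elements are taken from the type 'a.
   Results about it are polymorphic in 'a, hence not tied to a particular universe. *)
definition heaps :: "'p set \<Rightarrow> 'p rel \<Rightarrow> ('a, 'p) labelled set set" where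
  "heaps P C = {h. labelled_heap P C h} // heap_isomorphism P C"

lemma equiv_heap_isomorphism:
  "equiv {h. labelled_heap P C h} (heap_isomorphism P C :: ('a, 'p) labelled rel)"
proof (rule equivI)
  show "heap_isomorphism P C \<subseteq> {h. labelled_heap P C h} \<times> {h. labelled_heap P C h}"
    by (auto simp: heap_isomorphism_def)
  have "label_isomorphic h h" for h :: "('a, 'p) labelled"
    by (cases h) (auto intro!: exI[of _ id])
  then show "refl_on {h. labelled_heap P C h} (heap_isomorphism P C :: ('a, 'p) labelled rel)"
    by (auto simp: refl_on_def heap_isomorphism_def)
  have "label_isomorphic k h" if hk: "label_isomorphic h k" for h k :: "('a, 'p) labelled"
  proof -
    obtain E le e E' le' e' where [simp]: "h = (E, le, e)" "k = (E', le', e')"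
      by (cases h, cases k)
    from hk obtain f where f: "bij_betw f E E'"
      "\<And>x y. x \<in> E \<Longrightarrow> y \<in> E \<Longrightarrow> (x, y) \<in> le \<longleftrightarrow> (f x, f y) \<in> le'"
      "\<And>x. x \<in> E \<Longrightarrow> e' (f x) = e x" by auto
    let ?g = "inv_into E f"
    have g: "?g x \<in> E" "f (?g x) = x" if "x \<in> E'" for x
      using f(1) that by (auto simp: bij_betw_def inv_into_into f_inv_into_f)
    have "bij_betw ?g E' E" using f(1) by (rule bij_betw_inv_into)
    moreover have "(x, y) \<in> le' \<longleftrightarrow> (?g x, ?g y) \<in> le" if "x \<in> E'" "y \<in> E'" for x y
      using f(2)[of "?g x" "?g y"] g that by simp
    moreover have "e (?g x) = e' x" if "x \<in> E'" for x
      using f(3)[of "?g x"] g that by simp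
    ultimately show ?thesis by auto
  qed
  then show "sym (heap_isomorphism P C :: ('a, 'p) labelled rel)"
    by (auto simp: sym_def heap_isomorphism_def)
  have "label_isomorphic h l" if hk: "label_isomorphic h k" and kl: "label_isomorphic k l"
    for h k l :: "('a, 'p) labelled"
  proof -
    obtain E le e E' le' e' E'' le'' e'' where
      [simp]: "h = (E, le, e)" "k = (E', le', e')" "l = (E'', le'', e'')"
      by (cases h, cases k, cases l)
    from hk obtain f where f: "bij_betw f E E'"
      "\<And>x y. x \<in> E \<Longrightarrow> y \<in> E \<Longrightarrow> (x, y) \<in> le \<longleftrightarrow> (f x, f y) \<in> le'"
      "\<And>x. x \<in> E \<Longrightarrow> e' (f x) = e x" by auto
    from kl obtain g where g: "bij_betw g E' E''"
      "\<And>x y. x \<in> E' \<Longrightarrow> y \<in> E' \<Longrightarrow> (x, y) \<in> le' \<longleftrightarrow> (g x, g y) \<in> le''"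
      "\<And>x. x \<in> E' \<Longrightarrow> e'' (g x) = e' x" by auto
    have "f x \<in> E'" if "x \<in> E" for x using f(1) that by (auto simp: bij_betw_def)
    then show ?thesis
      using f g bij_betw_trans[OF f(1) g(1)] by (auto intro!: exI[of _ "g \<circ> f"])
  qed
  then show "trans (heap_isomorphism P C :: ('a, 'p) labelled rel)"
    unfolding trans_def heap_isomorphism_def by blast
qed

(* The simple graph is encoded as a symmetric loop-free digraph: the edge {v, w} is the
   pair of arcs (v, w) and (w, v). *)
definition concurrency_subgraph :: "'p rel \<Rightarrow> 'a set \<Rightarrow> ('a \<Rightarrow> 'p) \<Rightarrow> 'p pair_pre_digraph" where
  "concurrency_subgraph C E \<epsilon> =
     \<lparr> pverts = \<epsilon> ` E,
       parcs = {(v, w). v \<in> \<epsilon> ` E \<and> w \<in> \<epsilon> ` E \<and> v \<noteq> w \<and> (v, w) \<in> C} \<rparr>"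

(* The digraph notion of cycle admits v, w, v; a cycle of a simple graph has length
   at least 3. *)
definition has_circuit :: "'p pair_pre_digraph \<Rightarrow> bool" where
  "has_circuit G \<longleftrightarrow> (\<exists>p. pre_digraph.cycle (with_proj G) p \<and> 3 \<le> length p)"

end

theory Submission
  imports Defs
begin

text \<open>Only the construction of a rank function from ranked minimal balanced subintervals needs work.
  Elements with a common label form a chain, and the lengths of the minimal balanced subintervals
  define a rank on each such chain separately. For adjacent labels \<open>p\<close>, \<open>q\<close> the elements labelled
  \<open>p\<close> or \<open>q\<close> form a chain too; as \<open>{p, q}\<close> is a bridge of the concurrency graph, consecutive elements
  of that chain with different labels form a covering relation. Comparing such coverings inside a
  minimal balanced subinterval shows that the correction which the ranks on the two label classes
  require is the same at all of them. Finally, on a forest these corrections are the differences of a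
  potential on the labels, and adding the potential to the ranks of the chains gives a rank function.\<close>

section \<open>Finite posets\<close>

locale finite_poset =
  fixes E :: "'a set" and le :: "'a rel"
  assumes finite_carrier: "finite E" and order: "partial_order_on E le"
begin

abbreviation less :: "'a \<Rightarrow> 'a \<Rightarrow> bool" (infix "\<prec>" 50) where
  "x \<prec> y \<equiv> (x, y) \<in> le \<and> x \<noteq> y"

abbreviation cover :: "'a \<Rightarrow> 'a \<Rightarrow> bool" where
  "cover \<equiv> covering E le"

lemma le_refl: "x \<in> E \<Longrightarrow> (x, x) \<in> le"
  using order by (auto simp: partial_order_on_def preorder_on_def refl_on_def)

lemma le_in_carrier: "(x, y) \<in> le \<Longrightarrow> x \<in> E \<and> y \<in> E"
  using order by (auto simp: partial_order_on_def preorder_on_def refl_on_def)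

lemma le_trans: "(x, y) \<in> le \<Longrightarrow> (y, z) \<in> le \<Longrightarrow> (x, z) \<in> le"
  using order by (auto simp: partial_order_on_def preorder_on_def trans_def)

lemma le_antisym: "(x, y) \<in> le \<Longrightarrow> (y, x) \<in> le \<Longrightarrow> x = y"
  using order by (auto simp: partial_order_on_def antisym_def)

lemma less_trans: "x \<prec> y \<Longrightarrow> y \<prec> z \<Longrightarrow> x \<prec> z"
  by (metis le_trans le_antisym)

lemma cover_less: "cover x y \<Longrightarrow> x \<prec> y"
  by (simp add: covering_def)

lemma cover_between: "cover x y \<Longrightarrow> (x, z) \<in> le \<Longrightarrow> (z, y) \<in> le \<Longrightarrow> z = x \<or> z = y"
  using le_in_carrier by (auto simp: covering_def)

lemma finite_less: "finite {(x, y). x \<prec> y}"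
proof (rule finite_subset)
  show "{(x, y). x \<prec> y} \<subseteq> E \<times> E" using le_in_carrier by auto
qed (simp add: finite_carrier)

lemma acyclic_less: "acyclic {(x, y). x \<prec> y}"
proof -
  have "trans {(x, y). x \<prec> y}"
    unfolding trans_def mem_Collect_eq case_prod_conv using less_trans by blast
  then have "{(x, y). x \<prec> y}\<^sup>+ = {(x, y). x \<prec> y}" by (rule trancl_id)
  then show ?thesis by (simp add: acyclic_def)
qed

lemma wf_less: "wf {(x, y). x \<prec> y}"
  using finite_less acyclic_less by (rule finite_acyclic_wf)

lemma wf_greater: "wf {(y, x). x \<prec> y}"
proof -
  have "{(y, x). x \<prec> y} = {(x, y). x \<prec> y}\<inverse>" by auto
  then show ?thesis using finite_acyclic_wf_converse[OF finite_less acyclic_less] by (simp only:)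
qed

lemma minimal_element:
  assumes "P x"
  obtains m where "P m" "\<And>y. P y \<Longrightarrow> \<not> y \<prec> m"
proof -
  have "x \<in> Collect P" using assms by simp
  from wfE_min[OF wf_less this] obtain m
    where "m \<in> Collect P" and "\<And>y. y \<prec> m \<Longrightarrow> y \<notin> Collect P" by auto
  then show thesis using that by auto
qed

lemma maximal_element:
  assumes "P x"
  obtains m where "P m" "\<And>y. P y \<Longrightarrow> \<not> m \<prec> y"
proof -
  have "x \<in> Collect P" using assms by simp
  from wfE_min[OF wf_greater this] obtain m
    where "m \<in> Collect P" and "\<And>y. m \<prec> y \<Longrightarrow> y \<notin> Collect P" by auto
  then show thesis using that by auto
qed

lemma le_imp_cover_path:
  assumes "(x, y) \<in> le"
  shows "\<exists>n. (x, y) \<in> {(x, y). cover x y} ^^ n"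
  using assms
proof (induction y rule: wf_induct_rule[OF wf_less])
  case (1 y)
  show ?case
  proof (cases "x = y")
    case True
    then have "(x, y) \<in> {(x, y). cover x y} ^^ 0" by simp
    then show ?thesis by blast
  next
    case False
    obtain z where z: "(x, z) \<in> le \<and> z \<prec> y"
      and max: "\<And>w. (x, w) \<in> le \<and> w \<prec> y \<Longrightarrow> \<not> z \<prec> w"
      using maximal_element[of "\<lambda>z. (x, z) \<in> le \<and> z \<prec> y" x] 1(2) False le_refl le_in_carrier
      by metis
    have "cover z y"
      unfolding covering_def using z max le_in_carrier le_trans by meson
    moreover obtain n where "(x, z) \<in> {(x, y). cover x y} ^^ n"
      using 1(1)[of z] z by auto
    ultimately have "(x, y) \<in> {(x, y). cover x y} ^^ Suc n" by auto
    then show ?thesis by blast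
  qed
qed

section \<open>Coverings and chain lengths inside subintervals\<close>

lemma covering_subinterval:
  "covering (subinterval E le a b) (Restr le (subinterval E le a b)) x y \<longleftrightarrow>
    x \<in> subinterval E le a b \<and> y \<in> subinterval E le a b \<and> cover x y"
proof -
  \<comment> \<open>Subintervals are convex, so whatever separates two of their elements in
    \<open>E\<close> already lies in the subinterval.\<close>
  have "c \<in> subinterval E le a b"
    if "x \<in> subinterval E le a b" "y \<in> subinterval E le a b" "(x, c) \<in> le" "(c, y) \<in> le" for c
    using that le_trans le_in_carrier unfolding subinterval_def by blast
  moreover have "subinterval E le a b \<subseteq> E" by (auto simp: subinterval_def)
  ultimately show ?thesis unfolding covering_def by blast
qed

lemma ranked_imp_subinterval_ranked:
  "ranked E le \<Longrightarrow> subinterval_ranked E le a b"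
  unfolding subinterval_ranked_def ranked_def rank_function_def covering_subinterval by blast

lemma rank_function_subintervalD:
  assumes "rank_function (subinterval E le a b) (Restr le (subinterval E le a b)) r"
    and "(a, x) \<in> le" and "cover x y" and "(y, b) \<in> le"
  shows "r y = r x + 1"
proof -
  have xy: "(x, y) \<in> le" using cover_less assms(3) by blast
  then have "(a, y) \<in> le" "(x, b) \<in> le" using assms le_trans by blast+
  then have "x \<in> subinterval E le a b" "y \<in> subinterval E le a b"
    using assms xy le_in_carrier[OF xy] by (auto simp: subinterval_def)
  then show ?thesis
    using assms(1,3) by (simp add: rank_function_def covering_subinterval)
qed

text \<open>Meaningful only when all saturated chains from \<open>x\<close> to \<open>y\<close> have the same length,
  for instance when they lie in a ranked subinterval.\<close>

definition chain_length :: "'a \<Rightarrow> 'a \<Rightarrow> int" where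
  "chain_length x y = int (SOME n. (x, y) \<in> {(x, y). cover x y} ^^ n)"

text \<open>A rank function rises by one per step, so all saturated chains from \<open>x\<close> to
  \<open>y\<close> have the same length. This makes the arbitrary choice in
  \<open>chain_length\<close> harmless.\<close>

lemma cover_path_rank:
  assumes r: "rank_function (subinterval E le a b) (Restr le (subinterval E le a b)) r"
    and "(x, y) \<in> {(x, y). cover x y} ^^ n" and "(a, x) \<in> le" and "(y, b) \<in> le"
  shows "r y = r x + int n \<and> (x, y) \<in> le"
  using assms(2,4)
proof (induction n arbitrary: y)
  case 0
  then show ?case using assms(3) le_refl le_in_carrier by auto
next
  case (Suc n)
  then obtain z where z: "(x, z) \<in> {(x, y). cover x y} ^^ n" "cover z y" by auto
  have zy: "(z, y) \<in> le" using cover_less z(2) by blast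
  have IH: "r z = r x + int n" "(x, z) \<in> le"
    using Suc.IH[OF z(1)] le_trans[OF zy Suc.prems(2)] by auto
  have "(a, z) \<in> le" using IH(2) assms(3) le_trans by blast
  then have "r y = r z + 1" using rank_function_subintervalD[OF r] z(2) Suc.prems(2) by blast
  then show ?case using IH zy le_trans by auto
qed

lemma chain_length_eq_rank_diff:
  assumes "rank_function (subinterval E le a b) (Restr le (subinterval E le a b)) r"
    and "(a, x) \<in> le" and "(x, y) \<in> le" and "(y, b) \<in> le"
  shows "chain_length x y = r y - r x"
proof -
  have "(x, y) \<in> {(x, y). cover x y} ^^ (SOME n. (x, y) \<in> {(x, y). cover x y} ^^ n)"
    using le_imp_cover_path[OF assms(3)] by (rule someI_ex)
  from cover_path_rank[OF assms(1) this assms(2,4)] show ?thesis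
    by (simp add: chain_length_def)
qed

lemma chain_length_add:
  assumes "subinterval_ranked E le a b"
    and "(a, x) \<in> le" and "(x, y) \<in> le" and "(y, z) \<in> le" and "(z, b) \<in> le"
  shows "chain_length x z = chain_length x y + chain_length y z"
proof -
  obtain r where r: "rank_function (subinterval E le a b) (Restr le (subinterval E le a b)) r"
    using assms(1) by (auto simp: subinterval_ranked_def ranked_def)
  show ?thesis
    using chain_length_eq_rank_diff[OF r, of x z] chain_length_eq_rank_diff[OF r, of x y]
      chain_length_eq_rank_diff[OF r, of y z] assms(2-) le_trans by (smt (verit))
qed

lemma chain_length_cover:
  assumes "subinterval_ranked E le a b" and "(a, x) \<in> le" and "cover x y" and "(y, b) \<in> le"
  shows "chain_length x y = 1"
proof -
  obtain r where r: "rank_function (subinterval E le a b) (Restr le (subinterval E le a b)) r"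
    using assms(1) by (auto simp: subinterval_ranked_def ranked_def)
  have xy: "(x, y) \<in> le" using cover_less assms(3) by blast
  have "r y = r x + 1" using rank_function_subintervalD[OF r assms(2-4)] .
  then show ?thesis using chain_length_eq_rank_diff[OF r assms(2) xy assms(4)] by simp
qed

end

section \<open>Potentials on forests\<close>

text \<open>A path from \<open>p\<close> to \<open>q\<close> that avoids the edge between them
  closes up with that edge to a circuit.\<close>

lemma reachable_imp_has_circuit:
  fixes G :: "'p pair_pre_digraph"
  assumes G: "parcs G \<subseteq> pverts G \<times> pverts G" and "(q, p) \<in> parcs G" and "p \<noteq> q"
    and reach: "(p, q) \<in> (parcs G - {(p, q), (q, p)})\<^sup>*"
  shows "has_circuit G"
proof -
  define K where "K = \<lparr> pverts = pverts G, parcs = parcs G - {(p, q), (q, p)} \<rparr>"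
  interpret G: pair_wf_digraph G
    using G by unfold_locales auto
  interpret K: pair_wf_digraph K
    using G by unfold_locales (auto simp: K_def)
  have "(p, q) \<in> (parcs K)\<^sup>+"
    using reach \<open>p \<noteq> q\<close> by (auto simp: K_def rtrancl_eq_or_trancl)
  then have "p \<rightarrow>\<^sup>*\<^bsub>with_proj K\<^esub> q"
    using K.reachable1_reachable by simp
  then obtain w where w: "K.apath p w q" using K.reachable_apath by auto
  then have wK: "set w \<subseteq> parcs K" and cas: "pcas p w q" and "distinct (pawalk_verts p w)"
    by (auto simp: K.apath_def K.awalk_def)
  \<comment> \<open>A path of length one would be the deleted arc \<open>(p, q)\<close>. Length two
    leaves the closed walk with at least three arcs, as a circuit of a simple graph
    requires.\<close>
  have "2 \<le> length w"
  proof (cases w rule: remdups_adj.cases)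
    case 1
    then show ?thesis using cas \<open>p \<noteq> q\<close> by simp
  next
    case (2 e)
    then show ?thesis using cas wK by (cases e) (auto simp: K_def)
  qed simp
  moreover have "G.cycle ((q, p) # w)"
    using wK cas \<open>distinct _\<close> assms(2) G
    by (auto simp: G.cycle_def G.awalk_def K_def intro!: exI[of _ q])
  ultimately show ?thesis
    unfolding has_circuit_def by (intro exI[of _ "(q, p) # w"]) simp
qed

text \<open>Arcs are inserted one at a time. Each new edge is a bridge, so it joins two different
  components of what is already there, and shifting the potential on one of them adjusts the new
  difference without disturbing the old ones.\<close>

lemma forest_potential:
  fixes c :: "'p \<Rightarrow> 'p \<Rightarrow> int"
  assumes "finite F" and "F \<subseteq> G" and "sym G"
    and forest: "\<And>p q. (p, q) \<in> G \<Longrightarrow> (p, q) \<notin> (G - {(p, q), (q, p)})\<^sup>*"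
    and antisym: "\<And>p q. (p, q) \<in> F \<Longrightarrow> (q, p) \<in> F \<Longrightarrow> c q p = - c p q"
  shows "\<exists>k. \<forall>(p, q) \<in> F. k p - k q = c p q"
  using assms(1,2,5)
proof (induction F)
  case (insert e F)
  obtain p q where e: "e = (p, q)" by (cases e)
  obtain k where k: "\<forall>(p, q) \<in> F. k p - k q = c p q"
    using insert.IH insert.prems by blast
  show ?case
  proof (cases "(q, p) \<in> F")
    case True
    then have "k q - k p = c q p" using k by blast
    moreover have "c q p = - c p q" using insert.prems(2) True e by blast
    ultimately have "k p - k q = c p q" by simp
    then show ?thesis using k e by blast
  next
    case False
    let ?K = "(F \<union> F\<inverse>)\<^sup>*"
    \<comment> \<open>Neither orientation of the new edge occurs among the old arcs, so old paths
      survive the deletion of that edge.\<close>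
    have "F \<union> F\<inverse> \<subseteq> G - {(p, q), (q, p)}"
      using False insert.hyps insert.prems(1) \<open>sym G\<close> e by (auto simp: sym_def)
    then have "?K \<subseteq> (G - {(p, q), (q, p)})\<^sup>*" by (rule rtrancl_mono)
    then have pq: "(p, q) \<notin> ?K" using forest[of p q] insert.prems(1) e by blast
    have "sym ?K" by (intro sym_rtrancl sym_Un_converse)
    then have qp: "(q, p) \<notin> ?K" using pq symD by metis
    \<comment> \<open>The shift applies to the component of \<open>q\<close> only; its amount is the
      error of \<open>k\<close> on the new arc.\<close>
    define k' where "k' x = (if (q, x) \<in> ?K then k x + (k p - k q - c p q) else k x)" for x
    have "k' x - k' y = c x y" if "(x, y) \<in> F" for x y
    proof -
      have "(q, x) \<in> ?K \<longleftrightarrow> (q, y) \<in> ?K"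
        using that by (meson UnI1 UnI2 converseI rtrancl.rtrancl_into_rtrancl)
      then show ?thesis using k that by (auto simp: k'_def)
    qed
    moreover have "k' p - k' q = c p q" using qp by (simp add: k'_def)
    ultimately show ?thesis using e by blast
  qed
qed simp

section \<open>Heaps over a forest\<close>

locale forest_heap = finite_poset E le
  for E :: "'a set" and le :: "'a rel" +
  fixes C :: "'p rel" and \<epsilon> :: "'a \<Rightarrow> 'p"
  assumes C_refl: "x \<in> E \<Longrightarrow> (\<epsilon> x, \<epsilon> x) \<in> C"
    and C_sym: "sym C"
    and comparable: "x \<in> E \<Longrightarrow> y \<in> E \<Longrightarrow> (\<epsilon> x, \<epsilon> y) \<in> C \<Longrightarrow> (x, y) \<in> le \<or> (y, x) \<in> le"
    and generated: "le = {(x, y). (x, y) \<in> le \<and> (\<epsilon> x, \<epsilon> y) \<in> C}\<^sup>+"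
    and no_circuit: "\<not> has_circuit (concurrency_subgraph C E \<epsilon>)"
begin

abbreviation edges :: "'p rel" where
  "edges \<equiv> parcs (concurrency_subgraph C E \<epsilon>)"

lemma edges_iff: "(p, q) \<in> edges \<longleftrightarrow> p \<in> \<epsilon> ` E \<and> q \<in> \<epsilon> ` E \<and> p \<noteq> q \<and> (p, q) \<in> C"
  by (auto simp: concurrency_subgraph_def)

lemma sym_edges: "sym edges"
  using C_sym by (auto simp: sym_def edges_iff)

lemma edge_is_bridge:
  assumes "(p, q) \<in> edges"
  shows "(p, q) \<notin> (edges - {(p, q), (q, p)})\<^sup>*"
proof
  assume "(p, q) \<in> (edges - {(p, q), (q, p)})\<^sup>*"
  then have "has_circuit (concurrency_subgraph C E \<epsilon>)"
    using assms symD[OF sym_edges assms]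
    by (intro reachable_imp_has_circuit[of _ q p]) (auto simp: edges_iff concurrency_subgraph_def)
  then show False using no_circuit by blast
qed

text \<open>The order is generated by comparabilities between concurrent labels, and a generating
  chain from \<open>x\<close> to \<open>y\<close> has no room to visit a third element.\<close>

lemma cover_concurrent:
  assumes "cover x y"
  shows "(\<epsilon> x, \<epsilon> y) \<in> C"
proof -
  \<comment> \<open>The chain may rest at \<open>x\<close>, since \<open>le\<close> is reflexive,
    before it jumps to \<open>y\<close>; the jump itself is a generating pair.\<close>
  have "z = x \<or> z = y \<and> (\<epsilon> x, \<epsilon> y) \<in> C"
    if "(x, z) \<in> {(x, y). (x, y) \<in> le \<and> (\<epsilon> x, \<epsilon> y) \<in> C}\<^sup>+" "(z, y) \<in> le" for z
    using that
  proof (induction rule: trancl_induct)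
    case (base z)
    then show ?case using cover_between[OF assms, of z] by auto
  next
    case (step z w)
    then have zw: "(z, w) \<in> le" "(\<epsilon> z, \<epsilon> w) \<in> C" by auto
    then have "z = x \<or> z = y \<and> (\<epsilon> x, \<epsilon> y) \<in> C" using step le_trans by blast
    then show ?case
      using zw step.prems cover_between[OF assms, of w] le_antisym by blast
  qed
  moreover have "(x, y) \<in> {(x, y). (x, y) \<in> le \<and> (\<epsilon> x, \<epsilon> y) \<in> C}\<^sup>+"
    using cover_less[OF assms] generated by auto
  ultimately show ?thesis using cover_less[OF assms] le_refl le_in_carrier by blast
qed

text \<open>A saturated chain through a third element would trace a detour around the bridge
  between the labels of \<open>a\<close> and \<open>b\<close>.\<close>

lemma consecutive_imp_cover:
  assumes "a \<prec> b" and "(\<epsilon> a, \<epsilon> b) \<in> C" and "\<epsilon> a \<noteq> \<epsilon> b"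
    and consecutive: "\<And>c. a \<prec> c \<Longrightarrow> c \<prec> b \<Longrightarrow> \<epsilon> c \<noteq> \<epsilon> a \<and> \<epsilon> c \<noteq> \<epsilon> b"
  shows "cover a b"
proof (rule ccontr)
  assume "\<not> cover a b"
  then obtain c where c: "a \<prec> c" "c \<prec> b"
    using assms(1) le_in_carrier by (auto simp: covering_def)
  let ?S = "{(x, y). (x, y) \<in> le \<and> (\<epsilon> x, \<epsilon> y) \<in> C}"
  let ?K = "edges - {(\<epsilon> a, \<epsilon> b), (\<epsilon> b, \<epsilon> a)}"
  \<comment> \<open>A step whose two ends both avoid one of the labels of \<open>a\<close> and
    \<open>b\<close> cannot use the bridge.\<close>
  have K_step: "(\<epsilon> z, \<epsilon> w) \<in> ?K\<^sup>*"
    if "(z, w) \<in> ?S" and "\<epsilon> z \<noteq> l" "\<epsilon> w \<noteq> l" and "l = \<epsilon> a \<or> l = \<epsilon> b" for z w l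
  proof (cases "\<epsilon> z = \<epsilon> w")
    case False
    then have "(\<epsilon> z, \<epsilon> w) \<in> ?K" using that le_in_carrier by (auto simp: edges_iff)
    then show ?thesis by blast
  qed simp
  \<comment> \<open>Below \<open>b\<close> the label of \<open>b\<close> does not occur, so this
    half of the chain avoids the bridge; the half from \<open>c\<close> up to \<open>b\<close> is
    dual, with the label of \<open>a\<close>.\<close>
  have "(\<epsilon> a, \<epsilon> z) \<in> ?K\<^sup>*" if "(a, z) \<in> ?S\<^sup>+" "z \<prec> b" for z
    using that
  proof (induction rule: trancl_induct)
    case (base z)
    have "\<epsilon> z \<noteq> \<epsilon> b" using base assms(3) consecutive[of z] by auto
    then show ?case using K_step[of a z "\<epsilon> b"] base assms(3) by auto
  next
    case (step z w)
    have az: "(a, z) \<in> le" using step.hyps(1) generated by simp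
    have zw: "(z, w) \<in> le" using step.hyps(2) by simp
    have zb: "z \<prec> b" using zw step.prems le_trans le_antisym by blast
    have aw: "(a, w) \<in> le" using az zw le_trans by blast
    have "\<epsilon> z \<noteq> \<epsilon> b" "\<epsilon> w \<noteq> \<epsilon> b"
      using az zb aw step.prems assms(3) consecutive by metis+
    then have "(\<epsilon> z, \<epsilon> w) \<in> ?K\<^sup>*" using \<open>(z, w) \<in> ?S\<close> K_step[of z w "\<epsilon> b"] by blast
    then show ?case using step.IH[OF zb] by (meson rtrancl_trans)
  qed
  moreover have "(a, c) \<in> ?S\<^sup>+" "(c, b) \<in> ?S\<^sup>+" using c generated by auto
  moreover have "(\<epsilon> z, \<epsilon> b) \<in> ?K\<^sup>*" if "(z, b) \<in> ?S\<^sup>+" "a \<prec> z" for z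
    using that
  proof (induction rule: converse_trancl_induct)
    case (base z)
    have "\<epsilon> z \<noteq> \<epsilon> a" using base assms(3) consecutive[of z] by (cases "z = b") auto
    then show ?case using K_step[of z b "\<epsilon> a"] base assms(3) by auto
  next
    case (step w z)
    have zb: "(z, b) \<in> le" using step.hyps(2) generated by simp
    have wz: "(w, z) \<in> le" using step.hyps(1) by simp
    have az: "a \<prec> z" using wz step.prems le_trans le_antisym by blast
    have wb: "(w, b) \<in> le" using zb wz le_trans by blast
    have "\<epsilon> z \<noteq> \<epsilon> a" "\<epsilon> w \<noteq> \<epsilon> a"
      using az zb wb step.prems assms(3) consecutive by metis+
    then have "(\<epsilon> w, \<epsilon> z) \<in> ?K\<^sup>*" using \<open>(w, z) \<in> ?S\<close> K_step[of w z "\<epsilon> a"] by blast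
    then show ?case using step.IH[OF az] by (meson rtrancl_trans)
  qed
  ultimately have "(\<epsilon> a, \<epsilon> b) \<in> ?K\<^sup>*" using c by (meson rtrancl_trans)
  moreover have "(\<epsilon> a, \<epsilon> b) \<in> edges"
    using assms le_in_carrier by (auto simp: edges_iff)
  ultimately show False using edge_is_bridge by blast
qed

section \<open>Minimal balanced subintervals and heights on label classes\<close>

lemma minimal_balanced_iff:
  "minimal_balanced E le \<epsilon> a b \<longleftrightarrow>
    a \<prec> b \<and> \<epsilon> a = \<epsilon> b \<and> (\<forall>c. a \<prec> c \<and> c \<prec> b \<longrightarrow> \<epsilon> c \<noteq> \<epsilon> a)"
proof
  assume mb: "minimal_balanced E le \<epsilon> a b"
  then have set: "{c \<in> subinterval E le a b. \<epsilon> c = \<epsilon> a} = {a, b}"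
    unfolding minimal_balanced_def by (elim conjE)
  have "a \<noteq> b \<and> \<epsilon> a = \<epsilon> b"
    using mb unfolding minimal_balanced_def balanced_def by (elim conjE) (intro conjI)
  then have "a \<noteq> b" "\<epsilon> a = \<epsilon> b" by simp_all
  have "a \<in> subinterval E le a b" using set by blast
  then have "(a, b) \<in> le" by (simp add: subinterval_def)
  moreover have "\<epsilon> c \<noteq> \<epsilon> a" if "a \<prec> c" "c \<prec> b" for c
  proof
    assume "\<epsilon> c = \<epsilon> a"
    then have "c \<in> {a, b}"
      unfolding set[symmetric] using that le_in_carrier by (auto simp: subinterval_def)
    then show False using that by blast
  qed
  ultimately show "a \<prec> b \<and> \<epsilon> a = \<epsilon> b \<and> (\<forall>c. a \<prec> c \<and> c \<prec> b \<longrightarrow> \<epsilon> c \<noteq> \<epsilon> a)"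
    using \<open>a \<noteq> b\<close> \<open>\<epsilon> a = \<epsilon> b\<close> by blast
next
  assume ab: "a \<prec> b \<and> \<epsilon> a = \<epsilon> b \<and> (\<forall>c. a \<prec> c \<and> c \<prec> b \<longrightarrow> \<epsilon> c \<noteq> \<epsilon> a)"
  then have "a \<in> E" "b \<in> E" using le_in_carrier by blast+
  then have "{c \<in> subinterval E le a b. \<epsilon> c = \<epsilon> a} = {a, b}"
    using ab le_refl by (auto simp: subinterval_def)
  then show "minimal_balanced E le \<epsilon> a b"
    using ab by (simp add: minimal_balanced_def balanced_def)
qed

lemma obtain_label_predecessor:
  assumes "x \<prec> y" and "\<epsilon> x = \<epsilon> y"
  obtains a where "minimal_balanced E le \<epsilon> a y" and "(x, a) \<in> le"
proof -
  obtain a where a: "(x, a) \<in> le \<and> a \<prec> y \<and> \<epsilon> a = \<epsilon> y"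
    and max: "\<And>c. (x, c) \<in> le \<and> c \<prec> y \<and> \<epsilon> c = \<epsilon> y \<Longrightarrow> \<not> a \<prec> c"
    using maximal_element[of "\<lambda>a. (x, a) \<in> le \<and> a \<prec> y \<and> \<epsilon> a = \<epsilon> y" x]
      assms le_refl le_in_carrier by metis
  have "minimal_balanced E le \<epsilon> a y"
    unfolding minimal_balanced_iff using a max le_trans by metis
  then show thesis using that a by blast
qed

lemma same_label_comparable:
  "x \<in> E \<Longrightarrow> y \<in> E \<Longrightarrow> \<epsilon> x = \<epsilon> y \<Longrightarrow> (x, y) \<in> le \<or> (y, x) \<in> le"
  using comparable[of x y] C_refl[of x] by simp

text \<open>Telescopes along the label class of \<open>x\<close>, and so vanishes at its minimum.\<close>

definition height :: "'a \<Rightarrow> int" where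
  "height x = (\<Sum>(u, v) \<in> {(u, v). minimal_balanced E le \<epsilon> u v \<and> \<epsilon> v = \<epsilon> x \<and> (v, x) \<in> le}.
     chain_length u v)"

text \<open>Since a label class is a chain, passing from \<open>x\<close> to the next element
  \<open>y\<close> of its class adds exactly the pair \<open>(x, y)\<close> to the index set of the
  sum.\<close>

lemma height_minimal_balanced:
  assumes mb: "minimal_balanced E le \<epsilon> x y"
  shows "height y = height x + chain_length x y"
proof -
  define S where "S x = {(u, v). minimal_balanced E le \<epsilon> u v \<and> \<epsilon> v = \<epsilon> x \<and> (v, x) \<in> le}" for x
  have xy: "x \<prec> y" "\<epsilon> x = \<epsilon> y" and min: "\<And>c. x \<prec> c \<Longrightarrow> c \<prec> y \<Longrightarrow> \<epsilon> c \<noteq> \<epsilon> x"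
    using mb by (auto simp: minimal_balanced_iff)
  have inE: "x \<in> E" "y \<in> E" using xy le_in_carrier by blast+
  have "S x \<subseteq> E \<times> E"
    unfolding S_def minimal_balanced_iff using le_in_carrier by auto
  then have fin: "finite (S x)" using finite_carrier finite_subset by blast
  have notin: "(x, y) \<notin> S x" using xy le_antisym by (auto simp: S_def)
  have "(u, v) \<in> S y \<longleftrightarrow> (u, v) \<in> insert (x, y) (S x)" for u v
  proof
    assume uv: "(u, v) \<in> S y"
    then have v: "\<epsilon> v = \<epsilon> y" "(v, y) \<in> le" and u: "u \<prec> v" "\<epsilon> u = \<epsilon> v"
      and uv': "\<And>c. u \<prec> c \<Longrightarrow> c \<prec> v \<Longrightarrow> \<epsilon> c \<noteq> \<epsilon> u"
      by (auto simp: S_def minimal_balanced_iff)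
    have uvE: "u \<in> E" "v \<in> E" using u le_in_carrier by blast+
    show "(u, v) \<in> insert (x, y) (S x)"
    \<comment> \<open>If \<open>v = y\<close>, then \<open>u\<close> and \<open>x\<close> are both
      immediate predecessors of \<open>y\<close> in its class, hence equal. Otherwise
      \<open>v\<close> precedes \<open>y\<close> in the class, hence lies weakly below
      \<open>x\<close>.\<close>
    proof (cases "v = y")
      case True
      have "(u, x) \<in> le \<or> (x, u) \<in> le"
        using same_label_comparable[of u x] uvE inE u v xy by simp
      then have "u = x" using True min[of u] uv'[of x] xy u v by metis
      then show ?thesis using True by simp
    next
      case False
      have "(v, x) \<in> le \<or> (x, v) \<in> le"
        using same_label_comparable[of v x] uvE inE v xy by simp
      then have "(v, x) \<in> le" using False min[of v] xy v le_refl inE by metis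
      then show ?thesis using uv xy by (auto simp: S_def)
    qed
  next
    assume "(u, v) \<in> insert (x, y) (S x)"
    then show "(u, v) \<in> S y"
      using mb xy le_refl inE le_trans unfolding S_def by auto
  qed
  then have "S y = insert (x, y) (S x)" by auto
  then show ?thesis using fin notin by (simp add: height_def S_def[symmetric])
qed

text \<open>In a ranked subinterval chain lengths add up, so descending from \<open>y\<close>
  through label predecessors to \<open>x\<close> recovers the full length.\<close>

lemma height_diff:
  assumes ranked: "subinterval_ranked E le a b" and ax: "(a, x) \<in> le"
    and "(x, y) \<in> le" and "(y, b) \<in> le" and "\<epsilon> x = \<epsilon> y"
  shows "height y - height x = chain_length x y"
  using assms(3-)
proof (induction y rule: wf_induct_rule[OF wf_less])
  case (1 y)
  show ?case
  proof (cases "x = y")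
    case True
    then have "(x, x) \<in> le" "(x, b) \<in> le" using 1 by auto
    then have "chain_length x x = 0" using chain_length_add[OF ranked ax, of x x] by simp
    then show ?thesis using True by simp
  next
    case False
    then obtain z where z: "minimal_balanced E le \<epsilon> z y" "(x, z) \<in> le"
      using obtain_label_predecessor[of x y] 1 by blast
    then have zy: "z \<prec> y" "\<epsilon> z = \<epsilon> y" by (auto simp: minimal_balanced_iff)
    then have "(z, b) \<in> le" using 1 le_trans by blast
    then have "height z - height x = chain_length x z" using 1 z zy by simp
    moreover have "height y = height z + chain_length z y"
      using height_minimal_balanced[OF z(1)] .
    moreover have "chain_length x y = chain_length x z + chain_length z y"
      using chain_length_add[OF ranked ax z(2)] zy 1 by blast
    ultimately show ?thesis by simp
  qed
qed

text \<open>The correction between the label classes of \<open>s\<close> and \<open>t\<close> that makes the covering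
  \<open>s \<prec> t\<close> raise the rank by one.\<close>

definition offset :: "'a \<Rightarrow> 'a \<Rightarrow> int" where
  "offset s t = height t - height s - 1"

end

section \<open>Offsets between adjacent labels when minimal balanced subintervals are ranked\<close>

locale locally_ranked_forest_heap = forest_heap +
  assumes minimal_balanced_ranked:
    "minimal_balanced E le \<epsilon> a b \<Longrightarrow> subinterval_ranked E le a b"
begin

text \<open>With \<open>a\<close> the label predecessor of \<open>t\<close> and \<open>b\<close> the
  first element labelled like \<open>s\<close> above \<open>a\<close>, the ranked subinterval from
  \<open>a\<close> to \<open>t\<close> splits at \<open>b\<close> and \<open>s\<close>. Both outer
  pieces have length 1 and the middle one is a height difference, so the two offsets cancel.\<close>

lemma offset_preceding_cover:
  assumes st: "cover s t" and ne: "\<epsilon> s \<noteq> \<epsilon> t" and z: "z \<prec> t" "\<epsilon> z = \<epsilon> t"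
  obtains a b where "cover a b" "\<epsilon> a = \<epsilon> t" "\<epsilon> b = \<epsilon> s" "b \<prec> t" "offset a b = - offset s t"
proof -
  obtain a where a: "minimal_balanced E le \<epsilon> a t"
    using obtain_label_predecessor[OF z] by blast
  then have at: "a \<prec> t" "\<epsilon> a = \<epsilon> t" and min: "\<And>c. a \<prec> c \<Longrightarrow> c \<prec> t \<Longrightarrow> \<epsilon> c \<noteq> \<epsilon> a"
    by (auto simp: minimal_balanced_iff)
  have st': "s \<prec> t" using cover_less st by blast
  have C: "(\<epsilon> a, \<epsilon> s) \<in> C" using cover_concurrent[OF st] C_sym at by (auto dest: symD)
  have "a \<in> E" "s \<in> E" using at st' le_in_carrier by blast+
  then have "(a, s) \<in> le \<or> (s, a) \<in> le" using comparable C by blast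
  moreover have "a \<noteq> s" using ne at by auto
  ultimately have as: "a \<prec> s" using cover_between[OF st, of a] at by blast
  obtain b where b: "a \<prec> b \<and> (b, s) \<in> le \<and> \<epsilon> b = \<epsilon> s"
    and bmin: "\<And>c. a \<prec> c \<and> (c, s) \<in> le \<and> \<epsilon> c = \<epsilon> s \<Longrightarrow> \<not> c \<prec> b"
    using minimal_element[of "\<lambda>b. a \<prec> b \<and> (b, s) \<in> le \<and> \<epsilon> b = \<epsilon> s" s]
      as le_refl \<open>s \<in> E\<close> by metis
  have bt: "b \<prec> t" using b st' le_trans le_antisym by blast
  have ab: "cover a b"
  proof (rule consecutive_imp_cover)
    show "a \<prec> b" "(\<epsilon> a, \<epsilon> b) \<in> C" "\<epsilon> a \<noteq> \<epsilon> b" using b C at ne by auto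
    fix c assume c: "a \<prec> c" "c \<prec> b"
    have "(c, s) \<in> le" using c b le_trans by blast
    then have "\<epsilon> c \<noteq> \<epsilon> b" using bmin[of c] b c by auto
    moreover have "c \<prec> t" using less_trans c bt by blast
    ultimately show "\<epsilon> c \<noteq> \<epsilon> a \<and> \<epsilon> c \<noteq> \<epsilon> b" using min c by blast
  qed
  have ranked: "subinterval_ranked E le a t" using minimal_balanced_ranked a .
  have refl: "(a, a) \<in> le" "(t, t) \<in> le" using le_refl at le_in_carrier by blast+
  have "height t = height a + chain_length a t" using height_minimal_balanced[OF a] .
  moreover have "chain_length a t = chain_length a b + chain_length b t"
    using chain_length_add[OF ranked, of a b t] refl b bt by blast
  moreover have "chain_length b t = chain_length b s + chain_length s t"
    using chain_length_add[OF ranked, of b s t] refl b st' by blast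
  moreover have "chain_length a b = 1"
    using chain_length_cover[OF ranked refl(1) ab] bt by blast
  moreover have "chain_length s t = 1"
    using chain_length_cover[OF ranked _ st refl(2)] as by blast
  moreover have "height s - height b = chain_length b s"
    using height_diff[OF ranked, of b s] b st' by blast
  ultimately have "offset a b = - offset s t" by (simp add: offset_def)
  then show thesis using that ab at b bt by blast
qed

text \<open>Repeatedly passing to the preceding covering leads from any covering between the two
  labels down to the lowest one. Each pass reverses the direction of the labels and the sign of the
  offset.\<close>

lemma offset_constant:
  assumes "p \<noteq> q"
  shows "\<exists>v. \<forall>s t. cover s t \<longrightarrow>
    (\<epsilon> s = p \<and> \<epsilon> t = q \<longrightarrow> offset s t = v) \<and> (\<epsilon> s = q \<and> \<epsilon> t = p \<longrightarrow> offset s t = - v)"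
proof (cases "\<exists>s t. cover s t \<and> (\<epsilon> s = p \<and> \<epsilon> t = q \<or> \<epsilon> s = q \<and> \<epsilon> t = p)")
  case False
  then show ?thesis by blast
next
  case True
  define A where "A s t \<longleftrightarrow> cover s t \<and> (\<epsilon> s = p \<and> \<epsilon> t = q \<or> \<epsilon> s = q \<and> \<epsilon> t = p)" for s t
  \<comment> \<open>The sign normalises offsets to the direction from \<open>p\<close> to
    \<open>q\<close>, which makes the value invariant under passing to the preceding
    covering.\<close>
  define val where "val s t = (if \<epsilon> s = p then offset s t else - offset s t)" for s t
  obtain t\<^sub>1 where "\<exists>s. A s t\<^sub>1" using True unfolding A_def by blast
  then obtain t\<^sub>0 where "\<exists>s. A s t\<^sub>0" and min: "\<And>t. \<exists>s. A s t \<Longrightarrow> \<not> t \<prec> t\<^sub>0"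
    using minimal_element[of "\<lambda>t. \<exists>s. A s t" t\<^sub>1] by metis
  then obtain s\<^sub>0 where A\<^sub>0: "A s\<^sub>0 t\<^sub>0" by blast
  then have c\<^sub>0: "cover s\<^sub>0 t\<^sub>0" and less\<^sub>0: "s\<^sub>0 \<prec> t\<^sub>0" using cover_less by (auto simp: A_def)
  have E\<^sub>0: "s\<^sub>0 \<in> E" "t\<^sub>0 \<in> E" using less\<^sub>0 le_in_carrier by blast+
  have "val s t = val s\<^sub>0 t\<^sub>0" if "A s t" for s t
    using that
  proof (induction t arbitrary: s rule: wf_induct_rule[OF wf_less])
    case (1 t)
    then have c: "cover s t" and less: "s \<prec> t" and ne: "\<epsilon> s \<noteq> \<epsilon> t"
      using cover_less assms by (auto simp: A_def)
    have E: "s \<in> E" "t \<in> E" using less le_in_carrier by blast+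
    show ?case
    proof (cases "t = t\<^sub>0")
      \<comment> \<open>Two elements covered by \<open>t\<close> with the same label are comparable,
        so they coincide.\<close>
      case True
      then have "\<epsilon> s = \<epsilon> s\<^sub>0" using 1(2) A\<^sub>0 assms by (auto simp: A_def)
      then have "(s, s\<^sub>0) \<in> le \<or> (s\<^sub>0, s) \<in> le" using same_label_comparable E E\<^sub>0 by blast
      then have "s = s\<^sub>0"
        using cover_between[OF c, of s\<^sub>0] cover_between[OF c\<^sub>0, of s] less less\<^sub>0 True by blast
      then show ?thesis using True by simp
    next
      case False
      have "(\<epsilon> t\<^sub>0, \<epsilon> t) \<in> C"
        using 1(2) A\<^sub>0 cover_concurrent[OF c] C_sym C_refl[OF E(2)] by (auto simp: A_def dest: symD)
      then have "t\<^sub>0 \<prec> t" using comparable E E\<^sub>0 min False 1(2) by blast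
      moreover then have "s\<^sub>0 \<prec> t" using less_trans less\<^sub>0 by blast
      \<comment> \<open>The lowest covering carries both labels, so one of its ends is an earlier
        element with the label of \<open>t\<close>. This supplies the predecessor needed for the
        descent.\<close>
      moreover have "\<epsilon> s\<^sub>0 = \<epsilon> t \<or> \<epsilon> t\<^sub>0 = \<epsilon> t" using 1(2) A\<^sub>0 by (auto simp: A_def)
      ultimately obtain z where "z \<prec> t" "\<epsilon> z = \<epsilon> t" by blast
      then obtain a b where ab: "cover a b" "\<epsilon> a = \<epsilon> t" "\<epsilon> b = \<epsilon> s" "b \<prec> t"
          "offset a b = - offset s t"
        using offset_preceding_cover[OF c ne] by metis
      then have "A a b" using 1(2) by (auto simp: A_def)
      then have "val a b = val s\<^sub>0 t\<^sub>0" using 1(1) ab by blast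
      moreover have "val a b = val s t"
        using ab 1(2) assms by (auto simp: val_def A_def)
      ultimately show ?thesis by simp
    qed
  qed
  then have const: "val s t = val s\<^sub>0 t\<^sub>0"
    if "cover s t" "\<epsilon> s = p \<and> \<epsilon> t = q \<or> \<epsilon> s = q \<and> \<epsilon> t = p" for s t
    using that by (simp add: A_def)
  show ?thesis
  proof (intro exI[of _ "val s\<^sub>0 t\<^sub>0"] allI impI conjI)
    fix s t assume "cover s t"
    from const[OF this] show "offset s t = val s\<^sub>0 t\<^sub>0" if "\<epsilon> s = p \<and> \<epsilon> t = q"
      using that unfolding val_def[of s t] by simp
    from const[OF \<open>cover s t\<close>] show "offset s t = - val s\<^sub>0 t\<^sub>0" if "\<epsilon> s = q \<and> \<epsilon> t = p"
      using that assms unfolding val_def[of s t] by simp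
  qed
qed

lemma ranked: "ranked E le"
proof -
  obtain c where c: "\<And>p q s t. p \<noteq> q \<Longrightarrow> cover s t \<Longrightarrow>
    (\<epsilon> s = p \<and> \<epsilon> t = q \<longrightarrow> offset s t = c p q) \<and> (\<epsilon> s = q \<and> \<epsilon> t = p \<longrightarrow> offset s t = - c p q)"
    using offset_constant by metis
  \<comment> \<open>Only label pairs realised by a covering are constrained. On these
    \<open>c\<close> is antisymmetric, because one covering determines both \<open>c p q\<close> and
    \<open>c q p\<close>.\<close>
  define F where "F = {(\<epsilon> s, \<epsilon> t) | s t. cover s t \<and> \<epsilon> s \<noteq> \<epsilon> t}"
  have "F \<subseteq> edges"
    unfolding F_def using cover_concurrent cover_less le_in_carrier by (fastforce simp: edges_iff)
  moreover have "finite F"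
  proof (rule finite_subset)
    show "F \<subseteq> \<epsilon> ` E \<times> \<epsilon> ` E" using \<open>F \<subseteq> edges\<close> by (auto simp: edges_iff)
  qed (simp add: finite_carrier)
  moreover have "c q p = - c p q" if pq: "(p, q) \<in> F" for p q
  proof -
    obtain s t where "cover s t" "\<epsilon> s = p" "\<epsilon> t = q" "p \<noteq> q"
      using pq unfolding F_def by blast
    then show ?thesis using c[of p q s t] c[of q p s t] by simp
  qed
  ultimately obtain k where k: "\<forall>(p, q) \<in> F. k p - k q = c p q"
    using forest_potential[of F edges c] sym_edges edge_is_bridge by blast
  \<comment> \<open>Across a covering between different labels the heights rise by the offset plus
    one, and the potential falls by the offset.\<close>
  have "rank_function E le (\<lambda>x. height x + k (\<epsilon> x))"
    unfolding rank_function_def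
  proof (intro allI impI)
    fix s t assume st: "cover s t"
    show "height t + k (\<epsilon> t) = height s + k (\<epsilon> s) + 1"
    proof (cases "\<epsilon> s = \<epsilon> t")
      case True
      \<comment> \<open>A covering within a label class is itself a minimal balanced subinterval, of
        length 1.\<close>
      then have mb: "minimal_balanced E le \<epsilon> s t"
        using cover_less[OF st] cover_between[OF st] by (auto simp: minimal_balanced_iff)
      then have "chain_length s t = 1"
        using chain_length_cover[OF minimal_balanced_ranked[OF mb]] st cover_less[OF st]
          le_refl le_in_carrier by blast
      then show ?thesis using height_minimal_balanced[OF mb] True by simp
    next
      case False
      then have "k (\<epsilon> s) - k (\<epsilon> t) = c (\<epsilon> s) (\<epsilon> t)" using k st by (auto simp: F_def)
      moreover have "offset s t = c (\<epsilon> s) (\<epsilon> t)" using c[OF False st] by blast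
      ultimately show ?thesis unfolding offset_def by linarith
    qed
  qed
  then show ?thesis by (auto simp: ranked_def)
qed

end

theorem theorem2p1p1:
  fixes P :: "'p set" and C :: "'p rel"
    and H :: "('a, 'p) labelled set"
    and E :: "'a set" and le :: "'a rel" and \<epsilon> :: "'a \<Rightarrow> 'p"
  assumes "concurrency_relation P C"
    and "H \<in> heaps P C"
    and "(E, le, \<epsilon>) \<in> H"
    and "\<not> has_circuit (concurrency_subgraph C E \<epsilon>)"
  shows "(ranked E le \<longleftrightarrow>
            (\<forall>a\<in>E. \<forall>b\<in>E. subinterval_ranked E le a b)) \<and>
         ((\<forall>a\<in>E. \<forall>b\<in>E. subinterval_ranked E le a b) \<longleftrightarrow>
            (\<forall>a\<in>E. \<forall>b\<in>E. minimal_balanced E le \<epsilon> a b \<longrightarrow> subinterval_ranked E le a b))"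
proof -
  have "H \<subseteq> {h. labelled_heap P C h}"
    using assms(2) unfolding heaps_def by (rule in_quotient_imp_subset[OF equiv_heap_isomorphism])
  then have "labelled_heap P C (E, le, \<epsilon>)" using assms(3) by blast
  then have heap: "finite E" "partial_order_on E le" "\<epsilon> ` E \<subseteq> P"
    "\<forall>x\<in>E. \<forall>y\<in>E. (\<epsilon> x, \<epsilon> y) \<in> C \<longrightarrow> (x, y) \<in> le \<or> (y, x) \<in> le"
    "le = {(x, y). (x, y) \<in> le \<and> (\<epsilon> x, \<epsilon> y) \<in> C}\<^sup>+"
    unfolding labelled_heap.simps by - (elim conjE, assumption)+
  have C: "refl_on P C" "sym C" using assms(1) by (simp_all add: concurrency_relation_def)
  interpret forest_heap E le C \<epsilon>
  proof
    show "(\<epsilon> x, \<epsilon> x) \<in> C" if "x \<in> E" for x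
      using that heap(3) C(1) by (auto simp: refl_on_def)
    show "(x, y) \<in> le \<or> (y, x) \<in> le" if "x \<in> E" "y \<in> E" "(\<epsilon> x, \<epsilon> y) \<in> C" for x y
      using that heap(4) by blast
    show "finite E" by (fact heap(1))
    show "partial_order_on E le" by (fact heap(2))
    show "sym C" by (fact C(2))
    show "le = {(x, y). (x, y) \<in> le \<and> (\<epsilon> x, \<epsilon> y) \<in> C}\<^sup>+" by (fact heap(5))
    show "\<not> has_circuit (concurrency_subgraph C E \<epsilon>)" by (fact assms(4))
  qed
  \<comment> \<open>Only the step from minimal balanced subintervals to \<open>E\<close> remains:
    rank functions restrict to subintervals, and minimal balanced subintervals are among
    these.\<close>
  have "ranked E le"
    if min: "\<forall>a\<in>E. \<forall>b\<in>E. minimal_balanced E le \<epsilon> a b \<longrightarrow> subinterval_ranked E le a b"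
  proof -
    interpret locally_ranked_forest_heap E le C \<epsilon>
    proof
      fix a b assume "minimal_balanced E le \<epsilon> a b"
      then show "subinterval_ranked E le a b"
        using min le_in_carrier[of a b] by (auto simp: minimal_balanced_iff)
    qed
    show ?thesis by (rule ranked)
  qed
  then show ?thesis using ranked_imp_subinterval_ranked by blast
qed

end
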